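(* Let $r\geq 2$ be an integer and suppose that there exists a finite projective plane of order $r$. Then there exists an $(r,r+1;6)$-babi-graph of order $2(r^2+r)$.
   Context: Graphs are finite and simple. The girth of a graph is the length of its shortest cycle; the order of a graph is its number of vertices. For integers $1\leq r\leq s$ and $g\geq 3$, an $(r,s;g)$-balanced biregular graph (for short, $(r,s;g)$-babi-graph) is a graph of girth $g$ whose set of vertex degrees equals $\{r,s\}$ and in which the number of vertices of degree $r$ equals the number of vertices of degree $s$. A finite projective plane of order $q$ ($q\geq 2$) is an incidence structure with $q^2+q+1$ points and $q^2+q+1$ lines such that any two distinct points are incident with precisely one common line, any two distinct lines are incident with precisely one common point, each line is incident with exactly $q+1$ points, and each point is incident with exactly $q+1$ lines. *)

theory Defs
  imports "Graph_Theory.Pair_Digraph" "HOL-Library.Extended_Nat"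
begin

text \<open>
  A finite simple graph is a \<^locale>\<open>pair_graph\<close>: an irreflexive symmetric relation on a finite
  vertex set, each edge \<open>uv\<close> being represented by the two arcs \<open>(u, v)\<close> and \<open>(v, u)\<close>.  Hence the
  degree of a vertex is its out-degree.
\<close>

definition degree :: "'a pair_pre_digraph \<Rightarrow> 'a \<Rightarrow> nat" where
  "degree G v = out_degree (with_proj G) v"

text \<open>
  The closed walk \<open>u, v, u\<close> along an edge is a directed cycle of length 2 but not a cycle of the
  simple graph; it is excluded by the bound on the length.
\<close>

definition graph_cycle :: "'a pair_pre_digraph \<Rightarrow> ('a \<times> 'a) awalk \<Rightarrow> bool" where
  "graph_cycle G p \<longleftrightarrow> pre_digraph.cycle (with_proj G) p \<and> length p \<ge> 3"

text \<open>The infimum is taken in \<^typ>\<open>enat\<close>, so the girth of an acyclic graph is \<open>\<infinity>\<close>.\<close>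

definition girth :: "'a pair_pre_digraph \<Rightarrow> enat" where
  "girth G = (INF p\<in>{p. graph_cycle G p}. enat (length p))"

definition babi_graph :: "nat \<Rightarrow> nat \<Rightarrow> nat \<Rightarrow> 'a pair_pre_digraph \<Rightarrow> bool" where
  "babi_graph r s g G \<longleftrightarrow>
     1 \<le> r \<and> r \<le> s \<and> 3 \<le> g \<and>
     pair_graph G \<and>
     girth G = enat g \<and>
     degree G ` pverts G = {r, s} \<and>
     card {v \<in> pverts G. degree G v = r} = card {v \<in> pverts G. degree G v = s}"

locale finite_projective_plane =
  fixes Points :: "'p set" and Lines :: "'l set"
    and incident :: "'p \<Rightarrow> 'l \<Rightarrow> bool" and q :: nat
  assumes order_ge_2: "q \<ge> 2"
    and finite_Points: "finite Points"
    and finite_Lines: "finite Lines"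
    and card_Points: "card Points = q\<^sup>2 + q + 1"
    and card_Lines: "card Lines = q\<^sup>2 + q + 1"
    and joining_line: "\<lbrakk>x \<in> Points; y \<in> Points; x \<noteq> y\<rbrakk> \<Longrightarrow>
      \<exists>!l. l \<in> Lines \<and> incident x l \<and> incident y l"
    and meeting_point: "\<lbrakk>l \<in> Lines; m \<in> Lines; l \<noteq> m\<rbrakk> \<Longrightarrow>
      \<exists>!x. x \<in> Points \<and> incident x l \<and> incident x m"
    and card_points_on_line: "l \<in> Lines \<Longrightarrow> card {x \<in> Points. incident x l} = q + 1"
    and card_lines_through_point: "x \<in> Points \<Longrightarrow> card {l \<in> Lines. incident x l} = q + 1"

end

theory Submission
  imports Defs
begin

text \<open>
  The incidence graph of a projective plane of order \<open>r\<close> is \<open>(r + 1)\<close>-regular and has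
  \<open>2 (r\<^sup>2 + r + 1)\<close> vertices.  Delete a point \<open>p\<close> and a line \<open>l\<close> with \<open>p\<close> not on \<open>l\<close>.  This leaves
  \<open>2 (r\<^sup>2 + r)\<close> vertices, of which exactly the \<open>r + 1\<close> points on \<open>l\<close> and the \<open>r + 1\<close> lines through
  \<open>p\<close> have lost one neighbour; as \<open>p\<close> is not on \<open>l\<close>, none of these is itself deleted.  Half of the
  vertices must have degree \<open>r\<close>, so another \<open>(r\<^sup>2 + r) - 2 (r + 1) = (r + 1) (r - 2)\<close> vertices have
  to lose exactly one neighbour.  This number is even, and deleting a matching \<open>M\<close> of half as many
  edges between points off \<open>l\<close> and lines not through \<open>p\<close> has the required effect.

  Incidence between these \<open>r\<^sup>2 - 1\<close> points and \<open>r\<^sup>2 - 1\<close> lines is an \<open>r\<close>-regular bipartite graph, and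
  in a regular bipartite graph a greedy choice yields a matching that covers half of each side
  (\<open>bipartite_matching_exists\<close>), which is more than enough.

  Two lines meet only once, so a subgraph of the incidence graph has no cycle shorter than 6
  (\<open>length_cycle_ge_6\<close>).  A hexagon survives because \<open>M\<close> leaves at least two candidate points
  uncovered: together with a suitable point of \<open>l\<close> they form a triangle with no vertex covered by
  \<open>M\<close> and no side equal to \<open>l\<close> (\<open>triangle_with_vertex_on_line\<close>).
\<close>

section \<open>Greedy matchings in bipartite relations\<close>

text \<open>
  A matching is a relation on which both projections are injective.  As long as fewer than half of
  the elements of \<open>A\<close> are covered, the uncovered ones emit more edges than the covered elements of
  \<open>B\<close> can absorb, so some edge extends the matching.  The last extension starts with less than half
  covered, hence the bound on \<open>k\<close> is half of \<open>card A\<close> rounded up.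
\<close>

lemma bipartite_matching_exists:
  fixes R :: "('a \<times> 'b) set"
  assumes R: "R \<subseteq> A \<times> B" and fin: "finite A" "finite B" and "d > 0"
    and degA: "\<And>a. a \<in> A \<Longrightarrow> d \<le> card (R `` {a})"
    and degB: "\<And>b. b \<in> B \<Longrightarrow> card (R\<inverse> `` {b}) \<le> d"
    and "2 * k \<le> card A + 1"
  shows "\<exists>M \<subseteq> R. inj_on fst M \<and> inj_on snd M \<and> card M = k"
  using \<open>2 * k \<le> card A + 1\<close>
proof (induction k)
  case 0
  show ?case by (intro exI[of _ "{}"]) auto
next
  case (Suc k)
  then obtain M where M: "M \<subseteq> R" "inj_on fst M" "inj_on snd M" "card M = k" by auto
  have finR: "finite R" using R fin finite_subset by blast
  then have finM: "finite M" using M(1) finite_subset by blast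
  define U where "U = A - fst ` M"
  have "fst ` M \<subseteq> A" using M(1) R by auto
  then have "card U = card A - k"
    unfolding U_def using M(2,4) finM by (simp add: card_Diff_subset card_image)
  then have U: "card U > k" using Suc.prems by simp
  have "\<exists>a b. (a, b) \<in> R \<and> a \<in> U \<and> b \<notin> snd ` M"
  proof (rule ccontr)
    assume no_edge: "\<not> ?thesis"
    have finU: "finite U" unfolding U_def using fin by simp
    have finIm: "finite (R `` {a})" "finite (R\<inverse> `` {b})" for a b
      using finR by (auto intro: finite_Image)
    \<comment> \<open>Count the edges leaving \<open>U\<close> in two ways: all of them end in \<open>snd ` M\<close>, which has \<open>k < card U\<close> elements.\<close>
    have "d * card U \<le> (\<Sum>a\<in>U. card (R `` {a}))"
      using sum_mono[of U "\<lambda>_. d" "\<lambda>a. card (R `` {a})"] degA by (auto simp: U_def mult.commute)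
    also have "\<dots> = card (SIGMA a:U. R `` {a})"
      using finU finIm by (simp add: card_SigmaI)
    also have "\<dots> \<le> card ((\<lambda>(b, a). (a, b)) ` (SIGMA b:snd ` M. R\<inverse> `` {b}))"
      using no_edge finM finIm by (intro card_mono finite_imageI finite_SigmaI) (auto simp: image_iff)
    also have "\<dots> \<le> card (SIGMA b:snd ` M. R\<inverse> `` {b})"
      using finM finIm by (intro card_image_le finite_SigmaI) auto
    also have "\<dots> = (\<Sum>b\<in>snd ` M. card (R\<inverse> `` {b}))"
      using finM finIm by (intro card_SigmaI) auto
    also have "\<dots> \<le> (\<Sum>b\<in>snd ` M. d)"
      using M(1) R by (intro sum_mono degB) auto
    also have "\<dots> = d * k" using M(3,4) by (simp add: card_image)
    finally show False using U \<open>d > 0\<close> by simp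
  qed
  then obtain a b where ab: "(a, b) \<in> R" "a \<in> A" "a \<notin> fst ` M" "b \<notin> snd ` M"
    unfolding U_def by auto
  then have "(a, b) \<notin> M" by force
  then show ?case
    using M ab finM by (intro exI[of _ "insert (a, b) M"]) (auto simp: image_iff)
qed

section \<open>Graphs of bipartite relations\<close>

definition relation_graph :: "'a set \<Rightarrow> 'a rel \<Rightarrow> 'a pair_pre_digraph" where
  "relation_graph V E = \<lparr>pverts = V, parcs = E \<union> E\<inverse>\<rparr>"

locale bipartite_relation =
  fixes P L :: "'a set" and E :: "'a rel"
  assumes finite_parts: "finite P" "finite L"
    and disjoint: "P \<inter> L = {}"
    and edges: "E \<subseteq> P \<times> L"
begin

abbreviation "G \<equiv> relation_graph (P \<union> L) E"

lemma dual: "bipartite_relation L P (E\<inverse>)"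
  using finite_parts disjoint edges by unfold_locales auto

lemma pair_graph: "pair_graph G"
proof -
  have "finite E" using edges finite_parts finite_subset by blast
  moreover have "(x, x) \<notin> E" for x using edges disjoint by auto
  ultimately show ?thesis
    using edges finite_parts
    by unfold_locales (auto simp: relation_graph_def symmetric_def sym_def)
qed

lemma degree_left:
  assumes "v \<in> P"
  shows "degree G v = card (E `` {v})"
proof -
  have "out_arcs (with_proj G) v = Pair v ` (E `` {v})"
    using assms edges disjoint by (auto simp: out_arcs_def relation_graph_def)
  then show ?thesis by (simp add: degree_def out_degree_def card_image inj_on_def)
qed

lemma degree_right:
  assumes "v \<in> L"
  shows "degree G v = card (E\<inverse> `` {v})"
proof -
  interpret dual: bipartite_relation L P "E\<inverse>" by (rule dual)
  have "dual.G = G" by (simp add: relation_graph_def Un_commute)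
  then show ?thesis using dual.degree_left[OF assms] by simp
qed

text \<open>
  A bipartite graph has no odd cycle, and a 4-cycle is a pair of left vertices with two
  common neighbours.
\<close>

lemma length_cycle_ge_6:
  assumes no_rectangle: "\<And>x y a b. \<lbrakk>(x, a) \<in> E; (x, b) \<in> E; (y, a) \<in> E; (y, b) \<in> E; x \<noteq> y\<rbrakk> \<Longrightarrow> a = b"
    and "graph_cycle G p"
  shows "6 \<le> length p"
proof (rule ccontr)
  assume "\<not> 6 \<le> length p"
  interpret pair_graph G by (rule pair_graph)
  from assms(2) obtain u where arcs: "set p \<subseteq> parcs G" and cas: "pcas u p u"
    and dist: "distinct (tl (pawalk_verts u p))" and "length p \<ge> 3"
    by (auto simp: graph_cycle_def cycle_def awalk_def)
  have side: "(x \<in> P \<and> y \<in> L \<and> (x, y) \<in> E) \<or> (x \<in> L \<and> y \<in> P \<and> (y, x) \<in> E)"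
    if "(x, y) \<in> parcs G" for x y
    using that edges by (auto simp: relation_graph_def)
  have sides: "x \<notin> P \<or> x \<notin> L" for x using disjoint by auto
  from \<open>length p \<ge> 3\<close> \<open>\<not> 6 \<le> length p\<close> consider "length p = 3" | "length p = 4" | "length p = 5"
    by linarith
  then show False
  proof cases
    case 1
    then obtain e1 e2 e3 where p: "p = [e1, e2, e3]"
      by (auto simp: length_Suc_conv numeral_eq_Suc)
    obtain v w where "(u, v) \<in> parcs G" "(v, w) \<in> parcs G" "(w, u) \<in> parcs G"
      using arcs cas unfolding p by (cases e1; cases e2; cases e3) auto
    from this[THEN side] show False using sides by blast
  next
    case 2
    then obtain e1 e2 e3 e4 where p: "p = [e1, e2, e3, e4]"
      by (auto simp: length_Suc_conv numeral_eq_Suc)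
    obtain v w z where "(u, v) \<in> parcs G" "(v, w) \<in> parcs G" "(w, z) \<in> parcs G" "(z, u) \<in> parcs G"
      and "u \<noteq> w" "v \<noteq> z"
      using arcs cas dist unfolding p by (cases e1; cases e2; cases e3; cases e4) auto
    note arcs = this
    from arcs(1)[THEN side] show False
    proof
      assume "u \<in> P \<and> v \<in> L \<and> (u, v) \<in> E"
      then have "(u, v) \<in> E" "(w, v) \<in> E" "(w, z) \<in> E" "(u, z) \<in> E"
        using arcs(2-4)[THEN side] sides by blast+
      then show False using no_rectangle[of u v z w] \<open>u \<noteq> w\<close> \<open>v \<noteq> z\<close> by blast
    next
      assume "u \<in> L \<and> v \<in> P \<and> (v, u) \<in> E"
      then have "(v, u) \<in> E" "(v, w) \<in> E" "(z, w) \<in> E" "(z, u) \<in> E"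
        using arcs(2-4)[THEN side] sides by blast+
      then show False using no_rectangle[of v u w z] \<open>u \<noteq> w\<close> \<open>v \<noteq> z\<close> by blast
    qed
  next
    case 3
    then obtain e1 e2 e3 e4 e5 where p: "p = [e1, e2, e3, e4, e5]"
      by (auto simp: length_Suc_conv numeral_eq_Suc)
    obtain v w z t where "(u, v) \<in> parcs G" "(v, w) \<in> parcs G" "(w, z) \<in> parcs G"
      "(z, t) \<in> parcs G" "(t, u) \<in> parcs G"
      using arcs cas unfolding p by (cases e1; cases e2; cases e3; cases e4; cases e5) auto
    from this[THEN side] show False using sides by blast
  qed
qed

text \<open>
  The hexagon is that of a triangle with vertices \<open>x\<close>, \<open>y\<close>, \<open>z\<close> and opposite sides \<open>a\<close>, \<open>b\<close>, \<open>c\<close>.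
\<close>

lemma girth_eq_6:
  assumes no_rectangle: "\<And>x y a b. \<lbrakk>(x, a) \<in> E; (x, b) \<in> E; (y, a) \<in> E; (y, b) \<in> E; x \<noteq> y\<rbrakk> \<Longrightarrow> a = b"
    and hexagon: "(x, c) \<in> E" "(y, c) \<in> E" "(y, a) \<in> E" "(z, a) \<in> E" "(z, b) \<in> E" "(x, b) \<in> E"
    and "distinct [x, y, z]" "distinct [a, b, c]"
  shows "girth G = 6"
proof -
  interpret pair_graph G by (rule pair_graph)
  let ?p = "[(x, c), (c, y), (y, a), (a, z), (z, b), (b, x)]"
  have "{x, y, z} \<inter> {a, b, c} = {}" "x \<in> P" using hexagon edges disjoint by auto
  then have "cycle ?p"
    using assms unfolding cycle_def awalk_def
    by (intro exI[of _ x]) (auto simp: relation_graph_def)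
  then have "graph_cycle G ?p" by (simp add: graph_cycle_def)
  then have "girth G \<le> enat (length ?p)" unfolding girth_def by (intro INF_lower) auto
  then have "girth G \<le> enat 6" by (simp add: numeral_eq_Suc)
  moreover have "enat 6 \<le> girth G"
    unfolding girth_def using length_cycle_ge_6[OF no_rectangle] by (intro INF_greatest) auto
  ultimately show ?thesis by (simp add: numeral_eq_enat)
qed

end

section \<open>Counting in a projective plane with a deleted line and a deleted matching\<close>

lemma ex1_bij_betw:
  assumes "\<exists>!y. y \<in> B \<and> Q y" and h: "bij_betw h A B"
  shows "\<exists>!x. x \<in> A \<and> Q (h x)"
proof -
  obtain y where y: "y \<in> B" "Q y" and unique: "\<And>z. z \<in> B \<Longrightarrow> Q z \<Longrightarrow> z = y"
    using assms(1) by blast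
  obtain x where x: "x \<in> A" "h x = y" using y(1) h unfolding bij_betw_def by blast
  have "z = x" if z: "z \<in> A" "Q (h z)" for z
  proof -
    have "h z = h x" unfolding x(2) using z by (intro unique bij_betw_apply[OF h])
    then show ?thesis using inj_onD[OF bij_betw_imp_inj_on[OF h]] z x by blast
  qed
  moreover have "Q (h x)" using x y by simp
  ultimately show ?thesis using x(1) by blast
qed

context finite_projective_plane
begin

lemma dual: "finite_projective_plane Lines Points (\<lambda>l x. incident x l) q"
  using order_ge_2 finite_Points finite_Lines card_Points card_Lines joining_line meeting_point
    card_points_on_line card_lines_through_point
  by unfold_locales auto

lemma lines_through_two_points:
  "\<lbrakk>x \<in> Points; y \<in> Points; x \<noteq> y; l \<in> Lines; m \<in> Lines;
    incident x l; incident y l; incident x m; incident y m\<rbrakk> \<Longrightarrow> l = m"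
  using joining_line by blast

lemma card_lines_avoiding_point:
  assumes "x \<in> Points" "z \<in> Points" "x \<noteq> z"
  shows "card {y \<in> Lines. incident x y \<and> \<not> incident z y} = q"
proof -
  obtain m where m: "m \<in> Lines" "incident x m" "incident z m" using joining_line[OF assms] by blast
  then have "{y \<in> Lines. incident x y \<and> \<not> incident z y} = {y \<in> Lines. incident x y} - {m}"
    using joining_line[OF assms] by blast
  then show ?thesis using m card_lines_through_point[OF assms(1)] by simp
qed

lemma card_points_off_line:
  assumes "l \<in> Lines"
  shows "card {x \<in> Points. \<not> incident x l} = q\<^sup>2"
proof -
  have "{x \<in> Points. \<not> incident x l} = Points - {x \<in> Points. incident x l}" by auto
  then show ?thesis
    using card_Diff_subset[of "{x \<in> Points. incident x l}" Points] finite_Points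
      card_Points card_points_on_line[OF assms] by simp
qed

text \<open>
  The triangle is found by choosing \<open>x\<close> on \<open>l\<close> away from the line \<open>bc\<close>.  A side equal to \<open>l\<close> would
  contain \<open>b\<close> or \<open>c\<close>.
\<close>

lemma triangle_with_vertex_on_line:
  assumes l: "l \<in> Lines" and b: "b \<in> Points" "\<not> incident b l" and c: "c \<in> Points" "\<not> incident c l"
    and "b \<noteq> c"
  obtains x ab ac bc where "x \<in> Points" "incident x l" "{ab, ac, bc} \<subseteq> Lines - {l}"
    "incident x ab" "incident b ab" "incident x ac" "incident c ac" "incident b bc" "incident c bc"
    "distinct [x, b, c]" "distinct [bc, ac, ab]"
proof -
  interpret dual: finite_projective_plane Lines Points "\<lambda>l x. incident x l" q by (rule dual)
  obtain bc where bc: "bc \<in> Lines" "incident b bc" "incident c bc"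
    using joining_line[OF b(1) c(1) \<open>b \<noteq> c\<close>] by blast
  have "bc \<noteq> l" using bc b by blast
  have "card {x \<in> Points. incident x l \<and> \<not> incident x bc} = q"
    using dual.card_lines_avoiding_point[OF l bc(1)] \<open>bc \<noteq> l\<close> by simp
  then have "{x \<in> Points. incident x l \<and> \<not> incident x bc} \<noteq> {}"
    using order_ge_2 by (metis card.empty not_numeral_le_zero)
  then obtain x where x: "x \<in> Points" "incident x l" "\<not> incident x bc" by blast
  have ne: "x \<noteq> b" "x \<noteq> c" using x bc by auto
  obtain ab where ab: "ab \<in> Lines" "incident x ab" "incident b ab"
    using joining_line[OF x(1) b(1) ne(1)] by blast
  obtain ac where ac: "ac \<in> Lines" "incident x ac" "incident c ac"
    using joining_line[OF x(1) c(1) ne(2)] by blast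
  have "ab \<noteq> ac"
    using lines_through_two_points[OF b(1) c(1) \<open>b \<noteq> c\<close> ab(1) bc(1)] ab ac bc x by blast
  moreover have "bc \<noteq> ac" "bc \<noteq> ab" using ab ac x by auto
  moreover have "ab \<noteq> l" "ac \<noteq> l" using ab ac b c by auto
  ultimately show thesis
    using x ab ac bc ne \<open>b \<noteq> c\<close> \<open>bc \<noteq> l\<close> by (intro that[of x ab ac bc]) auto
qed

text \<open>
  No point suffers from both deletions, since \<open>M\<close> only meets points off \<open>l\<close>; and it suffers at most
  once from the second, since \<open>M\<close> is a matching.
\<close>

lemma card_remaining_lines:
  assumes "l \<in> Lines" "x \<in> Points"
    and M: "M \<subseteq> {(x, y). y \<in> Lines \<and> incident x y \<and> \<not> incident x l}" "inj_on fst M"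
  shows "card ({y \<in> Lines - {l}. incident x y} - M `` {x})
    = (if incident x l \<or> x \<in> fst ` M then q else q + 1)"
proof -
  let ?S = "{y \<in> Lines. incident x y}"
  have S: "card ?S = q + 1" using assms by (intro card_lines_through_point)
  consider "incident x l" | "\<not> incident x l" "x \<in> fst ` M" | "\<not> incident x l" "x \<notin> fst ` M" by blast
  then show ?thesis
  proof cases
    case 1
    then have "{y \<in> Lines - {l}. incident x y} - M `` {x} = ?S - {l}" using M(1) by auto
    with 1 S assms show ?thesis by simp
  next
    case 2
    then obtain y where y: "(x, y) \<in> M" by auto
    have "M `` {x} = {y}" using y inj_onD[OF M(2)] by fastforce
    then have "{y \<in> Lines - {l}. incident x y} - M `` {x} = ?S - {y}" using 2 by auto
    moreover have "y \<in> ?S" using y M(1) by auto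
    ultimately show ?thesis using S 2 by simp
  next
    case 3
    then have "{y \<in> Lines - {l}. incident x y} - M `` {x} = ?S" by force
    with 3 S show ?thesis by simp
  qed
qed

lemma card_points_losing_a_line:
  assumes "l \<in> Lines" "p \<in> Points" "\<not> incident p l"
    and M: "fst ` M \<subseteq> {x \<in> Points - {p}. \<not> incident x l}" "inj_on fst M"
  shows "card {x \<in> Points - {p}. incident x l \<or> x \<in> fst ` M} = q + 1 + card M"
proof -
  have "{x \<in> Points - {p}. incident x l \<or> x \<in> fst ` M} = {x \<in> Points. incident x l} \<union> fst ` M"
    using assms by auto
  also have "card \<dots> = card {x \<in> Points. incident x l} + card (fst ` M)"
  proof (rule card_Un_disjoint)
    show "finite {x \<in> Points. incident x l}" using finite_Points by simp
    show "finite (fst ` M)" by (rule finite_subset[OF M(1)]) (use finite_Points in simp)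
    show "{x \<in> Points. incident x l} \<inter> fst ` M = {}" using M(1) by blast
  qed
  also have "\<dots> = q + 1 + card M"
    by (simp only: card_points_on_line[OF \<open>l \<in> Lines\<close>] card_image[OF M(2)])
  finally show ?thesis .
qed

text \<open>
  Points and lines become vertices of one graph, so they must be disjoint sets of the same type; this
  allows any plane to be relabelled accordingly.
\<close>

lemma finite_projective_plane_transport:
  assumes f: "bij_betw f Points' Points" and g: "bij_betw g Lines' Lines"
  shows "finite_projective_plane Points' Lines' (\<lambda>x l. incident (f x) (g l)) q"
proof
  have f_in: "f x \<in> Points" if "x \<in> Points'" for x using f that by (auto simp: bij_betw_def)
  have g_in: "g l \<in> Lines" if "l \<in> Lines'" for l using g that by (auto simp: bij_betw_def)
  have f_inj: "f x = f y \<longleftrightarrow> x = y" if "x \<in> Points'" "y \<in> Points'" for x y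
    using f that by (auto simp: bij_betw_def inj_on_def)
  have g_inj: "g x = g y \<longleftrightarrow> x = y" if "x \<in> Lines'" "y \<in> Lines'" for x y
    using g that by (auto simp: bij_betw_def inj_on_def)
  have f_surj: "\<exists>x'\<in>Points'. f x' = x" if "x \<in> Points" for x
    using f that by (auto simp: bij_betw_def)
  have g_surj: "\<exists>l'\<in>Lines'. g l' = l" if "l \<in> Lines" for l
    using g that by (auto simp: bij_betw_def)
  show "q \<ge> 2" by (rule order_ge_2)
  show "finite Points'" "finite Lines'"
    using bij_betw_finite[OF f] bij_betw_finite[OF g] finite_Points finite_Lines by simp_all
  show "card Points' = q\<^sup>2 + q + 1" "card Lines' = q\<^sup>2 + q + 1"
    using bij_betw_same_card[OF f] bij_betw_same_card[OF g] card_Points card_Lines by simp_all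
  show "\<exists>!l. l \<in> Lines' \<and> incident (f x) (g l) \<and> incident (f y) (g l)"
    if "x \<in> Points'" "y \<in> Points'" "x \<noteq> y" for x y
  proof -
    have "\<exists>!l. l \<in> Lines \<and> incident (f x) l \<and> incident (f y) l"
      using that f_in f_inj by (intro joining_line) auto
    then show ?thesis using g by (rule ex1_bij_betw)
  qed
  show "\<exists>!x. x \<in> Points' \<and> incident (f x) (g l) \<and> incident (f x) (g m)"
    if "l \<in> Lines'" "m \<in> Lines'" "l \<noteq> m" for l m
  proof -
    have "\<exists>!x. x \<in> Points \<and> incident x (g l) \<and> incident x (g m)"
      using that g_in g_inj by (intro meeting_point) auto
    then show ?thesis using f by (rule ex1_bij_betw)
  qed
  show "card {x \<in> Points'. incident (f x) (g l)} = q + 1" if "l \<in> Lines'" for l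
  proof -
    have "f ` {x \<in> Points'. incident (f x) (g l)} = {x \<in> Points. incident x (g l)}"
      using f_in f_surj by blast
    moreover have "inj_on f {x \<in> Points'. incident (f x) (g l)}"
      using f_inj by (auto simp: inj_on_def)
    ultimately show ?thesis using card_image[of f] card_points_on_line[OF g_in[OF that]] by fastforce
  qed
  show "card {l \<in> Lines'. incident (f x) (g l)} = q + 1" if "x \<in> Points'" for x
  proof -
    have "g ` {l \<in> Lines'. incident (f x) (g l)} = {l \<in> Lines. incident (f x) l}"
      using g_in g_surj by blast
    moreover have "inj_on g {l \<in> Lines'. incident (f x) (g l)}"
      using g_inj by (auto simp: inj_on_def)
    ultimately show ?thesis using card_image[of g] card_lines_through_point[OF f_in[OF that]] by fastforce
  qed
qed

end

section \<open>The balanced biregular graph\<close>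

text \<open>
  The counts for lines are those for points in the dual plane, with \<open>p\<close> and \<open>l\<close> exchanged and \<open>M\<close>
  replaced by its converse.
\<close>

lemma babi_graph_of_plane:
  fixes Points Lines :: "'a set"
  assumes "finite_projective_plane Points Lines incident r" and "Points \<inter> Lines = {}"
  shows "\<exists>G :: 'a pair_pre_digraph. babi_graph r (r + 1) 6 G \<and> card (pverts G) = 2 * (r\<^sup>2 + r)"
proof -
  interpret finite_projective_plane Points Lines incident r by fact
  interpret dual: finite_projective_plane Lines Points "\<lambda>l x. incident x l" r by (rule dual)
  \<comment> \<open>Writing \<open>r = s + 2\<close> turns the size \<open>(r + 1) (r - 2) / 2\<close> of the matching into \<open>s (s + 3) / 2\<close>.\<close>
  obtain s where r: "r = s + 2" using order_ge_2 by (metis add.commute le_Suc_ex)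

  obtain l where l: "l \<in> Lines" using card_Lines by fastforce
  have "card {x \<in> Points. \<not> incident x l} \<noteq> 0" using card_points_off_line[OF l] r by simp
  then obtain p where p: "p \<in> Points" "\<not> incident p l" by (auto simp: card_eq_0_iff)

  define CP where "CP = {x \<in> Points - {p}. \<not> incident x l}"
  define CL where "CL = {y \<in> Lines - {l}. \<not> incident p y}"
  define R where "R = {(x, y) \<in> CP \<times> CL. incident x y}"
  have card_CP: "card CP = r\<^sup>2 - 1"
  proof -
    have "CP = {x \<in> Points. \<not> incident x l} - {p}" unfolding CP_def by auto
    then show ?thesis using p card_points_off_line[OF l] by simp
  qed
  have "\<exists>M \<subseteq> R. inj_on fst M \<and> inj_on snd M \<and> card M = s * (s + 3) div 2"
  proof (rule bipartite_matching_exists)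
    show "R \<subseteq> CP \<times> CL" unfolding R_def by auto
    show "finite CP" "finite CL" unfolding CP_def CL_def using finite_Points finite_Lines by auto
    show "r > 0" using r by simp
    show "r \<le> card (R `` {x})" if "x \<in> CP" for x
    proof -
      have "R `` {x} = {y \<in> Lines. incident x y \<and> \<not> incident p y}"
        using that unfolding R_def CP_def CL_def by auto
      then show ?thesis using card_lines_avoiding_point[of x p] that p unfolding CP_def by simp
    qed
    show "card (R\<inverse> `` {y}) \<le> r" if "y \<in> CL" for y
    proof -
      have "R\<inverse> `` {y} = {x \<in> Points. incident x y \<and> \<not> incident x l}"
        using that unfolding R_def CP_def CL_def by auto
      then show ?thesis using dual.card_lines_avoiding_point[of y l] that l unfolding CL_def by simp
    qed
    show "2 * (s * (s + 3) div 2) \<le> card CP + 1"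
      unfolding card_CP r by (simp add: power2_eq_square algebra_simps)
  qed
  then obtain M where M: "M \<subseteq> R" "inj_on fst M" "inj_on snd M" "card M = s * (s + 3) div 2"
    by blast
  have two_card_M: "2 * card M = s * (s + 3)" unfolding M(4) by simp
  have Mi: "(x, y) \<in> M \<Longrightarrow> x \<in> Points \<and> x \<noteq> p \<and> \<not> incident x l \<and> y \<in> Lines \<and> y \<noteq> l
      \<and> \<not> incident p y \<and> incident x y" for x y
    using M(1) unfolding R_def CP_def CL_def by auto
  have fst_M: "fst ` M \<subseteq> {x \<in> Points - {p}. \<not> incident x l}"
    and snd_M: "snd ` M \<subseteq> {y \<in> Lines - {l}. \<not> incident p y}"
    using M(1) by (auto simp: R_def CP_def CL_def)
  have "x = x'" if "(x, y) \<in> M" "(x', y) \<in> M" for x x' y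
    using inj_onD[OF M(3), of "(x, y)" "(x', y)"] that by simp
  then have inj_conv: "inj_on fst (M\<inverse>)" by (auto intro!: inj_onI)
  have fst_image_converse: "fst ` (M\<inverse>) = snd ` M" by (simp add: fst_eq_Domain snd_eq_Range)

  define P where "P = Points - {p}"
  define L where "L = Lines - {l}"
  define E where "E = {(x, y) \<in> P \<times> L. incident x y} - M"
  interpret bipartite_relation P L E
    using finite_Points finite_Lines assms(2) by unfold_locales (auto simp: P_def L_def E_def)

  have deg_P: "degree G x = (if incident x l \<or> x \<in> fst ` M then r else r + 1)" if "x \<in> P" for x
  proof -
    have "E `` {x} = {y \<in> Lines - {l}. incident x y} - M `` {x}"
      using that unfolding E_def P_def L_def by auto
    moreover have "M \<subseteq> {(x, y). y \<in> Lines \<and> incident x y \<and> \<not> incident x l}" using Mi by auto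
    ultimately show ?thesis
      using degree_left[OF that] card_remaining_lines[OF l _ _ M(2), of x] that
      by (simp add: P_def)
  qed
  have deg_L: "degree G y = (if incident p y \<or> y \<in> snd ` M then r else r + 1)" if "y \<in> L" for y
  proof -
    have "E\<inverse> `` {y} = {x \<in> Points - {p}. incident x y} - M\<inverse> `` {y}"
      using that unfolding E_def P_def L_def by auto
    moreover have "M\<inverse> \<subseteq> {(y, x). x \<in> Points \<and> incident x y \<and> \<not> incident p y}" using Mi by auto
    ultimately show ?thesis
      using degree_right[OF that] dual.card_remaining_lines[OF p(1) _ _ inj_conv, of y] that
      by (simp add: L_def fst_image_converse)
  qed

  have deg_r_iff: "x \<in> P \<Longrightarrow> degree G x = r \<longleftrightarrow> incident x l \<or> x \<in> fst ` M"
    "y \<in> L \<Longrightarrow> degree G y = r \<longleftrightarrow> incident p y \<or> y \<in> snd ` M" for x y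
    by (simp_all add: deg_P deg_L)
  have deg_cases: "degree G v = r \<or> degree G v = r + 1" if "v \<in> P \<union> L" for v
    using that by (metis UnE deg_P deg_L)

  let ?low = "{v \<in> P \<union> L. degree G v = r}"
  let ?high = "{v \<in> P \<union> L. degree G v = r + 1}"
  have card_V: "card (P \<union> L) = 2 * (r\<^sup>2 + r)"
    using finite_parts disjoint card_Points card_Lines p l
    by (simp add: card_Un_disjoint P_def L_def)
  have low: "card ?low = r\<^sup>2 + r"
  proof -
    have "?low = {x \<in> P. incident x l \<or> x \<in> fst ` M} \<union> {y \<in> L. incident p y \<or> y \<in> snd ` M}"
      using deg_r_iff by blast
    moreover have "card {x \<in> P. incident x l \<or> x \<in> fst ` M} = r + 1 + card M"
      unfolding P_def using l p fst_M M(2) by (rule card_points_losing_a_line)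
    moreover have "card {y \<in> L. incident p y \<or> y \<in> snd ` M} = r + 1 + card M"
    proof -
      have "card {y \<in> L. incident p y \<or> y \<in> fst ` (M\<inverse>)} = r + 1 + card (M\<inverse>)"
        unfolding L_def using p(1) l p(2) snd_M[folded fst_image_converse] inj_conv
        by (rule dual.card_points_losing_a_line)
      then show ?thesis unfolding fst_image_converse by simp
    qed
    moreover have "card ({x \<in> P. incident x l \<or> x \<in> fst ` M} \<union> {y \<in> L. incident p y \<or> y \<in> snd ` M})
      = card {x \<in> P. incident x l \<or> x \<in> fst ` M} + card {y \<in> L. incident p y \<or> y \<in> snd ` M}"
      using finite_parts disjoint by (intro card_Un_disjoint) auto
    ultimately have "card ?low = 2 * (r + 1) + 2 * card M"
      by simp
    then show ?thesis unfolding two_card_M r by (simp add: power2_eq_square algebra_simps)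
  qed
  have V: "P \<union> L = ?low \<union> ?high" using deg_cases by blast
  have high: "card ?high = r\<^sup>2 + r"
  proof -
    have "card (P \<union> L) = card ?low + card ?high"
      using finite_parts by (subst V, subst card_Un_disjoint) auto
    then show ?thesis using low card_V by simp
  qed
  have "r\<^sup>2 + r \<noteq> 0" using r by simp
  then have "card ?low \<noteq> 0" "card ?high \<noteq> 0" using low high by metis+
  then have "?low \<noteq> {}" "?high \<noteq> {}" by (metis card.empty)+
  then obtain u v where "u \<in> P \<union> L" "degree G u = r" "v \<in> P \<union> L" "degree G v = r + 1" by blast
  then have "{r, r + 1} \<subseteq> degree G ` (P \<union> L)" by (metis empty_subsetI image_eqI insert_subset)
  then have degrees: "degree G ` (P \<union> L) = {r, r + 1}" using deg_cases by blast

  have "girth G = 6"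
  proof -
    \<comment> \<open>Two uncovered candidate points and a point of \<open>l\<close>, which \<open>M\<close> never covers, span the hexagon.\<close>
    have "2 \<le> card (CP - fst ` M)"
    proof -
      have "card (CP - fst ` M) \<ge> card CP - card (fst ` M)"
        using finite_subset[OF fst_M] finite_Points by (intro diff_card_le_card_Diff) simp
      moreover have "2 * card CP \<ge> 4 + 2 * card M"
        unfolding two_card_M card_CP r by (simp add: power2_eq_square algebra_simps)
      ultimately show ?thesis using M(2) by (simp add: card_image)
    qed
    then obtain T where "T \<subseteq> CP - fst ` M" "card T = 2"
      by (rule obtain_subset_with_card_n)
    then obtain b c where bc: "b \<in> CP - fst ` M" "c \<in> CP - fst ` M" "b \<noteq> c"
      unfolding card_2_iff by blast
    have bc': "b \<in> Points" "c \<in> Points" "b \<noteq> p" "c \<noteq> p" "\<not> incident b l" "\<not> incident c l"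
      using bc by (auto simp: CP_def)
    obtain a ab ac bc where a: "a \<in> Points" "incident a l"
      and sides: "{ab, ac, bc} \<subseteq> Lines - {l}"
      and incidences: "incident a ab" "incident b ab" "incident a ac" "incident c ac"
        "incident b bc" "incident c bc"
      and distinct: "distinct [a, b, c]" "distinct [bc, ac, ab]"
      using triangle_with_vertex_on_line[OF l bc'(1,5) bc'(2,6) bc(3)] by blast
    have a_P: "a \<in> P" using a p by (auto simp: P_def)
    have uncovered: "{a, b, c} \<inter> fst ` M = {}" using a(2) bc fst_M by blast
    have in_E: "(x, y) \<in> E" if "x \<in> {a, b, c}" "y \<in> {ab, ac, bc}" "incident x y" for x y
    proof -
      have "x \<notin> fst ` M" using that uncovered by blast
      then have "(x, y) \<notin> M" by (metis fst_conv image_eqI)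
      moreover have "x \<in> P" using that a_P bc' by (auto simp: P_def)
      moreover have "y \<in> L" using that sides by (auto simp: L_def)
      ultimately show ?thesis using that by (simp add: E_def)
    qed
    show ?thesis
    proof (rule girth_eq_6)
      show "y = y'" if "(x, y) \<in> E" "(x, y') \<in> E" "(x', y) \<in> E" "(x', y') \<in> E" "x \<noteq> x'" for x x' y y'
        using that lines_through_two_points[of x x' y y'] by (auto simp: E_def P_def L_def)
      show "(a, ab) \<in> E" "(b, ab) \<in> E" "(b, bc) \<in> E" "(c, bc) \<in> E" "(c, ac) \<in> E" "(a, ac) \<in> E"
        using incidences by (auto intro: in_E)
    qed (use distinct in auto)
  qed
  then have "babi_graph r (r + 1) 6 G"
    using pair_graph degrees low high r
    by (simp add: babi_graph_def relation_graph_def numeral_eq_enat)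
  moreover have "card (pverts G) = 2 * (r\<^sup>2 + r)" using card_V by (simp add: relation_graph_def)
  ultimately show ?thesis by blast
qed

theorem theorem6p3:
  fixes r :: nat
    and Points :: "'p set" and Lines :: "'l set" and incident :: "'p \<Rightarrow> 'l \<Rightarrow> bool"
  assumes "r \<ge> 2"
    and "finite_projective_plane Points Lines incident r"
  shows "\<exists>G :: nat pair_pre_digraph.
    babi_graph r (r + 1) 6 G \<and> card (pverts G) = 2 * (r\<^sup>2 + r)"
proof -
  interpret finite_projective_plane Points Lines incident r by fact
  let ?n = "r\<^sup>2 + r + 1"
  obtain f where f: "bij_betw f {0..<?n} Points"
    using finite_same_card_bij[of "{0..<?n}" Points] finite_Points card_Points by auto
  obtain g where g: "bij_betw g {?n..<2 * ?n} Lines"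
    using finite_same_card_bij[of "{?n..<2 * ?n}" Lines] finite_Lines card_Lines by auto
  show ?thesis
    by (rule babi_graph_of_plane[OF finite_projective_plane_transport[OF f g]]) auto
qed

end
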